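(* Let $G$ be a plane weighted graph with $2n$ vertices. Let $2k$ distinct vertices $a_1, b_1, a_2, b_2, \ldots, a_k, b_k$, where $2 \leq k \leq n$, appear in this cyclic order on a face of $G$, and let $A=\{a_1,\ldots,a_k\}$ and $B=\{b_1,\ldots,b_k\}$. Then for every partition of $A$ into disjoint subsets $A_1, A_2$ (so $A = A_1\cup A_2$), we have \[ \sum_{W\subseteq B,\ |W| \text{ even}} M(G-W)\,M(G-A-\overline{W}) = \sum_{Y\subseteq B,\ |Y|-|A_1| \text{ even}} M(G-A_1-Y)\,M(G-A_2-\overline{Y}), \] where $\overline{W}=B\setminus W$ and $\overline{Y}=B\setminus Y$; the first sum ranges over all subsets $W$ of $B$ of even cardinality and the second over all subsets $Y$ of $B$ with $|Y|\equiv |A_1| \pmod 2$.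
   Context: For a weighted graph $G$, the weight of a perfect matching is the product of the weights of its edges, and $M(G)$ denotes the sum of the weights of all perfect matchings of $G$ (for an unweighted graph, the number of perfect matchings; $M$ of a graph with no perfect matching is $0$). For a set $U$ of vertices, $G-U$ denotes the subgraph of $G$ induced by the vertices not in $U$; $G-A-W$ means $G-(A\cup W)$. *)

theory Defs
  imports "HOL-Analysis.Analysis"
begin

text \<open>
  A plane graph in the usual sense: the vertices are points of the plane (identified with the
  complex numbers) and the edges are arcs, represented by their point sets. The ends of an edge
  are the vertices lying on it. Parallel edges are permitted; loops are not arcs.
\<close>

record drawing =
  verts :: "complex set"
  edges :: "complex set set"

definition plane_graph :: "drawing \<Rightarrow> bool" where
  "plane_graph G \<longleftrightarrow>
     finite (verts G) \<and> finite (edges G) \<and>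
     (\<forall>e\<in>edges G. \<exists>g. arc g \<and> path_image g = e \<and> e \<inter> verts G = {pathstart g, pathfinish g}) \<and>
     (\<forall>e\<in>edges G. \<forall>f\<in>edges G. e \<noteq> f \<longrightarrow> e \<inter> f \<subseteq> verts G)"

definition delete_verts :: "drawing \<Rightarrow> complex set \<Rightarrow> drawing" where
  "delete_verts G U = \<lparr> verts = verts G - U, edges = {e \<in> edges G. e \<inter> U = {}} \<rparr>"

definition perfect_matchings :: "drawing \<Rightarrow> complex set set set" where
  "perfect_matchings G = {\<mu>. \<mu> \<subseteq> edges G \<and> (\<forall>v\<in>verts G. \<exists>!e. e \<in> \<mu> \<and> v \<in> e)}"

definition matching_sum :: "(complex set \<Rightarrow> 'w::comm_ring_1) \<Rightarrow> drawing \<Rightarrow> 'w" where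
  "matching_sum w G = (\<Sum>\<mu>\<in>perfect_matchings G. \<Prod>e\<in>\<mu>. w e)"

definition faces :: "drawing \<Rightarrow> complex set set" where
  "faces G = components (- (verts G \<union> \<Union>(edges G)))"

text \<open>
  The vertices \<open>vs\<close> appear in this cyclic order on the face \<open>F\<close>: some simple closed curve meets
  the drawing exactly in these vertices, in the given order, and otherwise runs in \<open>F\<close> together
  with its interior. If the boundary of \<open>F\<close> is connected, this says that \<open>vs\<close> can be read off in
  this order along the facial boundary walk, in either direction. The condition on the interior
  keeps the whole graph on one side of the curve; it matters when \<open>F\<close> has a disconnected
  boundary or a cut vertex, where a curve in \<open>F\<close> could otherwise have parts of the graph on both
  sides. It is no restriction for the unbounded face, since a curve around the graph can be
  replaced by one bounding a slit annulus.
\<close>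

definition in_cyclic_order_on_face :: "drawing \<Rightarrow> complex set \<Rightarrow> complex list \<Rightarrow> bool" where
  "in_cyclic_order_on_face G F vs \<longleftrightarrow>
     F \<in> faces G \<and> set vs \<subseteq> verts G \<and>
     (\<exists>c t. simple_path c \<and> pathfinish c = pathstart c \<and>
        path_image c \<subseteq> F \<union> set vs \<and> inside (path_image c) \<subseteq> F \<and>
        (\<forall>i<length vs. 0 \<le> t i \<and> t i < 1 \<and> c (t i) = vs ! i) \<and>
        (\<forall>i j. i < j \<and> j < length vs \<longrightarrow> t i < (t j :: real)))"

end

theory Submission
  imports Defs
begin

text \<open>
  Superimpose the two matchings counted by a term of either sum. Every terminal (vertex of
  \<open>A \<union> B\<close>) is covered exactly once and every other vertex twice, so each component of the
  superposition contains zero or two terminals. By the Jordan curve theorem these pairs do not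
  cross, so no component contains two vertices of \<open>A\<close>. Exchanging the two matchings on
  the components that meet \<open>A1\<close> is therefore a weight-preserving bijection between the terms of
  the two sums; the parity conditions only omit terms that vanish.
\<close>

subsection \<open>Crossing chords of a simple closed curve\<close>

text \<open>Nothing of the drawing lies inside the curve \<open>c\<close> through the terminals,
  whereas the theta-curve theorem describes how a chord splits the inside of a closed curve.
  Inversion at a point inside \<open>c\<close> carries the outside into the inside of the image
  curve. Noncrossing keeps two vertices of \<open>A\<close> apart only because \<open>A\<close> and
  \<open>B\<close> alternate: the terminals strictly between two paired ones are paired among
  themselves, so paired positions differ in parity, while \<open>A\<close> occupies even positions.
  The number of terminals in a component comes from counting edges; no classification into paths and
  cycles is made. Both sums are instances of one sum over all U \<subseteq> A \<union> B with
  \<open>U \<inter> A = S\<close>, where the first matching misses \<open>U\<close> and the second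
  misses the other terminals. The choice \<open>S = {}\<close> gives the left side and
  \<open>S = A1\<close> the right side.\<close>

lemma crossing_chords_inside:
  fixes c p q :: "real \<Rightarrow> complex"
  assumes c: "simple_path c" "pathfinish c = pathstart c"
    and st: "0 < s" "s < u" "u < t" "t < 1"
    and p: "arc p" "pathstart p = c 0" "pathfinish p = c u"
      "path_image p \<inter> path_image c = {c 0, c u}" "path_image p - {c 0, c u} \<subseteq> inside (path_image c)"
    and q: "arc q" "pathstart q = c s" "pathfinish q = c t"
      "path_image q \<inter> path_image c = {c s, c t}" "path_image q - {c s, c t} \<subseteq> inside (path_image c)"
  shows "path_image p \<inter> path_image q \<noteq> {}"
proof
  assume disj: "path_image p \<inter> path_image q = {}"
  \<comment> \<open>The ends of \<open>p\<close> cut \<open>c\<close> into two arcs, one containing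
    \<open>c s\<close> and the other \<open>c t\<close>. The second is traversed backwards from
    \<open>c 1 = c 0\<close>, so that \<open>c1\<close>, \<open>c2\<close> and \<open>p\<close> form
    a theta curve with common start and end.\<close>
  define c1 c2 where "c1 = subpath 0 u c" and "c2 = subpath 1 u c"
  have loop: "c 1 = c 0"
    using c by (simp add: pathfinish_def pathstart_def)
  have inj: "x = y" if "c x = c y" "x \<in> {0..1}" "y \<in> {0<..<1}" for x y
    using that c(1) unfolding simple_path_def loop_free_def by fastforce
  have im1: "path_image c1 = c ` {0..u}" and im2: "path_image c2 = c ` {u..1}"
    using st by (auto simp: c1_def c2_def path_image_subpath_gen closed_segment_eq_real_ivl)
  have "{0..1} = {0..u} \<union> {u..1}"
    using st by auto
  then have "path_image c = c ` ({0..u} \<union> {u..1})"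
    by (simp only: path_image_def)
  then have im: "path_image c1 \<union> path_image c2 = path_image c"
    by (simp only: im1 im2 image_Un)
  have ne: "c 0 \<noteq> c u"
    using inj[of 0 u] st by auto
  have int12: "path_image c1 \<inter> path_image c2 = {c 0, c u}"
  proof
    show "path_image c1 \<inter> path_image c2 \<subseteq> {c 0, c u}"
    proof
      fix z assume "z \<in> path_image c1 \<inter> path_image c2"
      then obtain x y where xy: "x \<in> {0..u}" "y \<in> {u..1}" "z = c x" "z = c y"
        by (auto simp: im1 im2)
      then show "z \<in> {c 0, c u}"
        using inj[of x y] st loop by (cases "y = 1") auto
    qed
    show "{c 0, c u} \<subseteq> path_image c1 \<inter> path_image c2"
      using st by (auto simp: im1 im2 intro: image_eqI[of _ _ 1] simp: loop)
  qed
  have simp1: "simple_path c1"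
    unfolding c1_def using st c by (intro simple_path_subpath) auto
  have simp2: "simple_path c2"
    unfolding c2_def using st c by (intro simple_path_subpath) auto
  have mid: "p (1/2) \<in> path_image p" "q (1/2) \<in> path_image q"
    by (auto simp: path_image_def)
  have pmid: "p (1/2) \<notin> {c 0, c u}"
  proof -
    have "p (1/2) \<noteq> p 0" "p (1/2) \<noteq> p 1"
      using p(1) by (auto simp: arc_def inj_on_eq_iff)
    then show ?thesis
      using p(2,3) by (auto simp: pathstart_def pathfinish_def)
  qed
  have qmid: "q (1/2) \<notin> {c s, c t}"
  proof -
    have "q (1/2) \<noteq> q 0" "q (1/2) \<noteq> q 1"
      using q(1) by (auto simp: arc_def inj_on_eq_iff)
    then show ?thesis
      using q(2,3) by (auto simp: pathstart_def pathfinish_def)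
  qed
  have pc: "path_image c1 \<inter> path_image p = {c 0, c u}" "path_image c2 \<inter> path_image p = {c 0, c u}"
    using p(4) im int12 by blast+
  have "path_image p \<inter> inside (path_image c1 \<union> path_image c2) \<noteq> {}"
    unfolding im using mid pmid p(5) by blast
  \<comment> \<open>Theta-curve theorem: \<open>p\<close> divides the inside of \<open>c\<close>
    into one region bounded by \<open>c1\<close> and \<open>p\<close> and another bounded by
    \<open>c2\<close> and \<open>p\<close>.\<close>
  from split_inside_simple_closed_curve[OF simp1 _ _ simp2 _ _ arc_imp_simple_path[OF p(1)]
      p(2,3) ne int12 pc this]
  have in12: "inside (path_image c1 \<union> path_image p) \<union> inside (path_image c2 \<union> path_image p) \<union>
         (path_image p - {c 0, c u}) = inside (path_image c)"
    using loop im by (auto simp: c1_def c2_def)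
  have cont: "continuous_on {0..1} q"
    using q(1) by (simp add: arc_def path_def)
  \<comment> \<open>Here \<open>T\<close> is \<open>q\<close> without one end, so it meets
    \<open>c\<close> only at the other end \<open>z\<close>. It starts in a region bounded by
    \<open>ci\<close> and \<open>p\<close> and avoids \<open>p\<close>, so it can reach
    \<open>z\<close> only if \<open>z\<close> lies on that boundary. Each case below takes for
    \<open>z\<close> the end of \<open>q\<close> on the opposite arc.\<close>
  have tail: "z \<in> path_image ci \<union> path_image p"
    if T: "z \<in> T" "q (1/2) \<in> T" "connected T" "T \<subseteq> path_image q" "{c s, c t} \<inter> T \<subseteq> {z}"
      and ci: "path_image ci \<subseteq> path_image c"
      and z: "z \<in> path_image c" "q (1/2) \<in> inside (path_image ci \<union> path_image p)" 
      and sub: "inside (path_image ci \<union> path_image p) \<subseteq> inside (path_image c)"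
    for z T and ci :: "real \<Rightarrow> complex"
  proof (rule ccontr)
    assume z': "z \<notin> path_image ci \<union> path_image p"
    have "z \<notin> inside (path_image c)"
      using z(1) inside_no_overlap by blast
    then have "z \<in> outside (path_image ci \<union> path_image p)"
      using z' sub by (auto simp: inside_outside)
    then have "(path_image ci \<union> path_image p) \<inter> T \<noteq> {}"
      using inside_outside_intersect_connected[of T "path_image ci \<union> path_image p"] T z by blast
    moreover have "path_image ci \<inter> T \<subseteq> {z}"
      using T ci q(4) by blast
    ultimately show False
      using T(4) disj z' by blast
  qed
  have "q (1/2) \<in> inside (path_image c)"
    using mid qmid q(5) by blast
  then consider "q (1/2) \<in> inside (path_image c1 \<union> path_image p)"
    | "q (1/2) \<in> inside (path_image c2 \<union> path_image p)"
    using in12 mid disj by blast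
  then show False
  proof cases
    case 1
    have "c t \<in> path_image c1 \<union> path_image p"
    proof (rule tail[of _ "q ` {0<..1}"])
      show "connected (q ` {0<..1})"
        by (intro connected_continuous_image continuous_on_subset[OF cont]) auto
      show "q ` {0<..1} \<subseteq> path_image q" "c t \<in> q ` {0<..1}"
        using q(3) by (auto simp: path_image_def pathfinish_def intro: image_eqI[of _ _ 1])
      have "q x \<noteq> q 0" if "x \<in> {0<..1}" for x
        using q(1) that by (auto simp: arc_def inj_on_eq_iff)
      then show "{c s, c t} \<inter> q ` {0<..1} \<subseteq> {c t}"
        using q(2) by (auto simp: pathstart_def)
      show "c t \<in> path_image c"
        using q(4) by blast
    qed (use 1 im in12 in auto)
    moreover have "c t \<notin> path_image p"
      using disj q(4) by blast
    moreover have "c t \<notin> path_image c1"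
    proof
      assume "c t \<in> path_image c1"
      then obtain x where x: "x \<in> {0..u}" "c x = c t"
        by (auto simp: im1)
      then have "x = t"
        using st by (intro inj) auto
      then show False
        using x st by auto
    qed
    ultimately show False by blast
  next
    case 2
    have "c s \<in> path_image c2 \<union> path_image p"
    proof (rule tail[of _ "q ` {0..<1}"])
      show "connected (q ` {0..<1})"
        by (intro connected_continuous_image continuous_on_subset[OF cont]) auto
      show "q ` {0..<1} \<subseteq> path_image q" "c s \<in> q ` {0..<1}"
        using q(2) by (auto simp: path_image_def pathstart_def intro: image_eqI[of _ _ 0])
      have "q x \<noteq> q 1" if "x \<in> {0..<1}" for x
        using q(1) that by (auto simp: arc_def inj_on_eq_iff)
      then show "{c s, c t} \<inter> q ` {0..<1} \<subseteq> {c s}"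
        using q(3) by (auto simp: pathfinish_def)
      show "c s \<in> path_image c"
        using q(4) by blast
    qed (use 2 im in12 in auto)
    moreover have "c s \<notin> path_image p"
      using disj q(4) by blast
    moreover have "c s \<notin> path_image c2"
    proof
      assume "c s \<in> path_image c2"
      then obtain x where x: "x \<in> {u..1}" "c x = c s"
        by (auto simp: im2)
      then have "x = s"
        using st by (intro inj) auto
      then show False
        using x st by auto
    qed
    ultimately show False by blast
  qed
qed

text \<open>The image of the connected outside lies on one side of the image curve. If it missed the
  inside, so would the image of the punctured inside, which has unbounded points near
  \<open>z0\<close>. The inside of the image curve would then be at most {0}, but it is open and
  nonempty.\<close>

lemma inversion_outside_subset_inside:
  fixes c :: "real \<Rightarrow> complex"
  defines "f \<equiv> \<lambda>z0 z. inverse (z - z0)"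
  assumes c: "simple_path c" "pathfinish c = pathstart c" and z0: "z0 \<in> inside (path_image c)"
  shows "simple_path (f z0 \<circ> c)"
    "f z0 ` outside (path_image c) \<subseteq> inside (path_image (f z0 \<circ> c))"
proof -
  let ?f = "f z0"
  note J = Jordan_inside_outside[OF c]
  have z0': "z0 \<notin> path_image c" "z0 \<notin> outside (path_image c)"
    using z0 J by blast+
  \<comment> \<open>The convention \<open>inverse 0 = 0\<close> makes the map injective on the whole
    plane, \<open>z0\<close> included.\<close>
  have inj: "inj ?f"
    by (auto simp: f_def inj_on_def)
  have cont: "continuous_on S ?f" if "z0 \<notin> S" for S
    unfolding f_def using that by (intro continuous_intros) auto
  show sc: "simple_path (?f \<circ> c)"
    using c(1) z0' inj by (intro simple_path_continuous_image cont) (auto intro: inj_on_subset)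
  have im: "path_image (?f \<circ> c) = ?f ` path_image c"
    by (simp add: path_image_compose)
  have loop': "pathfinish (?f \<circ> c) = pathstart (?f \<circ> c)"
    using c(2) by (simp add: pathfinish_compose pathstart_compose)
  note J' = Jordan_inside_outside[OF sc loop']
  show "?f ` outside (path_image c) \<subseteq> inside (path_image (?f \<circ> c))"
  proof (rule ccontr)
    assume "\<not> ?thesis"
    then obtain y where y: "y \<in> outside (path_image c)" "?f y \<notin> inside (path_image (?f \<circ> c))"
      by blast
    have disj: "?f ` S \<inter> path_image (?f \<circ> c) = {}" if "S \<inter> path_image c = {}" for S
      using that inj unfolding im by (metis image_Int image_empty)
    have conn: "?f ` S \<inter> inside (path_image (?f \<circ> c)) = {}"
      if "connected S" "z0 \<notin> S" "S \<inter> path_image c = {}" "x \<in> S" "?f x \<notin> inside (path_image (?f \<circ> c))"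
      for S x
    proof -
      have *: "connected (?f ` S)"
        using that by (intro connected_continuous_image cont) auto
      have "?f x \<notin> path_image (?f \<circ> c)"
        using disj[OF that(3)] that(4) by blast
      then have "?f x \<in> outside (path_image (?f \<circ> c))"
        using that(5) by (auto simp: inside_outside)
      with disj[OF that(3)] inside_outside_intersect_connected[OF *] that(4)
      show ?thesis by blast
    qed
    have out: "?f ` outside (path_image c) \<inter> inside (path_image (?f \<circ> c)) = {}"
      using y J z0' by (intro conn[of _ y]) auto
    have "bounded (inside (path_image (?f \<circ> c)))"
      using J' by blast
    then obtain B where B: "B > 0" "\<And>z. z \<in> inside (path_image (?f \<circ> c)) \<Longrightarrow> norm z < B"
      unfolding bounded_pos_less by blast
    obtain e where e: "e > 0" "ball z0 e \<subseteq> inside (path_image c)"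
      using J z0 by (meson open_contains_ball)
    \<comment> \<open>The bound \<open>e/2\<close> keeps the point at distance \<open>d\<close> from
      \<open>z0\<close> inside \<open>c\<close>; the bound \<open>inverse B\<close> makes its image
      have modulus at least \<open>B\<close>, too large for the inside of the image curve.\<close>
    define d where "d = min (e/2) (inverse B)"
    have d: "d > 0" "d < e" "inverse d \<ge> B"
      using e(1) B(1) by (auto simp: d_def min_def field_simps)
    define x where "x = z0 + of_real d"
    have x: "x \<in> inside (path_image c) - {z0}"
      using e d by (auto simp: x_def dist_norm subset_iff)
    have "norm (?f x) = inverse d"
      using d by (simp add: f_def x_def norm_inverse)
    then have fx: "?f x \<notin> inside (path_image (?f \<circ> c))"
      using B(2)[of "?f x"] d(3) by auto
    have ins: "?f ` (inside (path_image c) - {z0}) \<inter> inside (path_image (?f \<circ> c)) = {}"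
    proof (rule conn[OF _ _ _ x fx])
      show "connected (inside (path_image c) - {z0})"
        using J by (intro connected_open_delete) auto
    qed (use inside_no_overlap[of "path_image c"] in blast)+
    \<comment> \<open>Every nonzero point is the image of a point other than \<open>z0\<close>, and
      all three parts of the punctured plane have been excluded.\<close>
    have "inside (path_image (?f \<circ> c)) \<subseteq> {0}"
    proof
      fix z assume z: "z \<in> inside (path_image (?f \<circ> c))"
      show "z \<in> {0}"
      proof (rule ccontr)
        assume "z \<notin> {0}"
        then have fz: "z = ?f (z0 + inverse z)" and ne: "z0 + inverse z \<noteq> z0"
          by (auto simp: f_def)
        have "z0 + inverse z \<notin> path_image c"
        proof
          assume "z0 + inverse z \<in> path_image c"
          then have "z \<in> path_image (?f \<circ> c)"
            unfolding im by (subst fz) (rule imageI)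
          then show False
            using z inside_no_overlap by blast
        qed
        then have "z0 + inverse z \<in> (inside (path_image c) - {z0}) \<union> outside (path_image c)"
          using ne by (auto simp: inside_outside)
        then show False
          using ins out z fz by blast
      qed
    qed
    then have "inside (path_image (?f \<circ> c)) = {0}"
      using J' by blast
    then show False
      using J' not_open_singleton[of "0::complex"] by auto
  qed
qed

text \<open>Both arcs avoid the inside of \<open>c\<close> and hence the pole \<open>z0\<close>, so
  inversion turns them into chords running inside the image curve. Injectivity carries the common
  point back.\<close>

lemma crossing_chords_outside:
  fixes c p q :: "real \<Rightarrow> complex"
  assumes c: "simple_path c" "pathfinish c = pathstart c"
    and st: "0 < s" "s < u" "u < t" "t < 1"
    and p: "arc p" "pathstart p = c 0" "pathfinish p = c u"
      "path_image p \<inter> path_image c = {c 0, c u}" "path_image p \<inter> inside (path_image c) = {}"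
    and q: "arc q" "pathstart q = c s" "pathfinish q = c t"
      "path_image q \<inter> path_image c = {c s, c t}" "path_image q \<inter> inside (path_image c) = {}"
  shows "path_image p \<inter> path_image q \<noteq> {}"
proof -
  obtain z0 where z0: "z0 \<in> inside (path_image c)"
    using Jordan_inside_outside[OF c] by blast
  define f where "f z = inverse (z - z0)" for z
  have inj: "inj f"
    by (auto simp: f_def inj_on_def)
  have cont: "continuous_on S f" if "z0 \<notin> S" for S
    unfolding f_def using that by (intro continuous_intros) auto
  note inv = inversion_outside_subset_inside[OF c z0, folded f_def]
  have imI: "path_image (f \<circ> g) = f ` path_image g" for g :: "real \<Rightarrow> complex"
    by (simp add: path_image_compose)
  have arcI: "arc (f \<circ> g)" if "arc g" "path_image g \<inter> inside (path_image c) = {}" for g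
    using that z0 unfolding arc_def
    by (auto intro!: path_continuous_image cont comp_inj_on intro: inj_on_subset[OF inj])
  have meet: "path_image (f \<circ> g) \<inter> path_image (f \<circ> c) = {(f \<circ> c) x, (f \<circ> c) y}"
    if "path_image g \<inter> path_image c = {c x, c y}" for g x y
    unfolding imI image_Int[OF inj, symmetric] that by simp
  have ins: "path_image (f \<circ> g) - {(f \<circ> c) x, (f \<circ> c) y} \<subseteq> inside (path_image (f \<circ> c))"
    if "path_image g \<inter> path_image c = {c x, c y}" "path_image g \<inter> inside (path_image c) = {}" for g x y
  proof -
    have "path_image g - {c x, c y} \<subseteq> outside (path_image c)"
      using that by (auto simp: inside_outside)
    then show ?thesis
      using inv(2) unfolding imI by auto
  qed
  have "path_image (f \<circ> p) \<inter> path_image (f \<circ> q) \<noteq> {}"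
  proof (rule crossing_chords_inside[of "f \<circ> c" s u t])
    show "pathfinish (f \<circ> c) = pathstart (f \<circ> c)"
      using c(2) by (simp add: pathfinish_compose pathstart_compose)
    show "pathstart (f \<circ> p) = (f \<circ> c) 0" "pathfinish (f \<circ> p) = (f \<circ> c) u"
      "pathstart (f \<circ> q) = (f \<circ> c) s" "pathfinish (f \<circ> q) = (f \<circ> c) t"
      using p q by (simp_all add: pathfinish_compose pathstart_compose)
  qed (rule inv(1) st arcI[OF p(1,5)] arcI[OF q(1,5)] meet[OF p(4)] meet[OF q(4)]
      ins[OF p(4,5)] ins[OF q(4,5)])+
  then show ?thesis
    unfolding imI image_Int[OF inj, symmetric] by blast
qed

text \<open>Stated for sets because a component of a superposition is drawn as a union of edges;
  suitable arcs are extracted from it.\<close>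

lemma crossing_connections_outside:
  fixes c :: "real \<Rightarrow> complex"
  assumes c: "simple_path c" "pathfinish c = pathstart c"
    and t: "0 \<le> t1" "t1 < t2" "t2 < t3" "t3 < t4" "t4 < 1"
    and P: "path_component P (c t1) (c t3)" "P \<inter> path_image c = {c t1, c t3}" "P \<inter> inside (path_image c) = {}"
    and Q: "path_component Q (c t2) (c t4)" "Q \<inter> path_image c = {c t2, c t4}" "Q \<inter> inside (path_image c) = {}"
  shows "P \<inter> Q \<noteq> {}"
proof -
  have arc: "\<exists>g. arc g \<and> path_image g \<subseteq> S \<and> pathstart g = x \<and> pathfinish g = y"
    if "path_component S x y" "x \<noteq> y" for S and x y :: complex
    using that path_contains_arc unfolding path_component_def by (metis order.trans)
  have ne: "c x \<noteq> c y" if "x < y" "0 \<le> x" "y < 1" for x y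
    using c(1) that unfolding simple_path_def loop_free_def by force
  obtain p where p: "arc p" "path_image p \<subseteq> P" "pathstart p = c t1" "pathfinish p = c t3"
    using arc[OF P(1)] ne[of t1 t3] t by auto
  obtain q where q: "arc q" "path_image q \<subseteq> Q" "pathstart q = c t2" "pathfinish q = c t4"
    using arc[OF Q(1)] ne[of t2 t4] t by auto
  \<comment> \<open>Rotating the parameter puts the first of the four points at 0, as the statement
    on chords requires.\<close>
  define d where "d = shiftpath t1 c"
  have d: "d 0 = c t1" "d (t2 - t1) = c t2" "d (t3 - t1) = c t3" "d (t4 - t1) = c t4"
    using t by (auto simp: d_def shiftpath_def)
  have im: "path_image d = path_image c"
    unfolding d_def using t c by (intro path_image_shiftpath) auto
  have "path_image p \<inter> path_image q \<noteq> {}"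
  proof (rule crossing_chords_outside[of d "t2 - t1" "t3 - t1" "t4 - t1"])
    show "simple_path d" "pathfinish d = pathstart d"
      using t c by (auto simp: d_def simple_path_shiftpath closed_shiftpath)
    show "path_image p \<inter> path_image d = {d 0, d (t3 - t1)}"
      "path_image q \<inter> path_image d = {d (t2 - t1), d (t4 - t1)}"
      using p q P Q pathstart_in_path_image[of p] pathfinish_in_path_image[of p]
        pathstart_in_path_image[of q] pathfinish_in_path_image[of q] unfolding im d by auto
  qed (use t p q P Q in \<open>auto simp: d im\<close>)
  then show ?thesis
    using p q by blast
qed

subsection \<open>Superposition of two matchings\<close>

text \<open>An edge may contain points other than its ends, which are \<open>e \<inter> V\<close>.
  Arcs in the plane thus serve as edges directly, and parallel edges stay distinct.\<close>

locale vertex_edge_system =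
  fixes V :: "'a set" and E :: "'a set set"
  assumes finite_V: "finite V" and finite_E: "finite E"
    and card_ends: "e \<in> E \<Longrightarrow> card (e \<inter> V) = 2"
begin

text \<open>These are the perfect matchings of the subgraph induced on \<open>X\<close>, kept as
  subsets of the one edge set \<open>E\<close> so that matchings of different subgraphs can be
  superimposed.\<close>

definition matchings_on :: "'a set \<Rightarrow> 'a set set set" where
  "matchings_on X = {\<mu>. \<mu> \<subseteq> E \<and> (\<forall>e\<in>\<mu>. e \<inter> V \<subseteq> X) \<and> (\<forall>v\<in>X. \<exists>!e. e \<in> \<mu> \<and> v \<in> e)}"

definition adjacent :: "'a set set \<Rightarrow> 'a rel" where
  "adjacent N = {(u, v). \<exists>e\<in>N. u \<in> e \<inter> V \<and> v \<in> e \<inter> V}"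

definition component_of :: "'a set set \<Rightarrow> 'a \<Rightarrow> 'a set" where
  "component_of N v = (adjacent N)\<^sup>* `` {v}"

text \<open>No edge of \<open>N\<close> leaves \<open>K\<close>; unions of components are the
  intended instances.\<close>

definition saturated :: "'a set set \<Rightarrow> 'a set \<Rightarrow> bool" where
  "saturated N K \<longleftrightarrow> (\<forall>e\<in>N. e \<inter> V \<subseteq> K \<or> e \<inter> V \<inter> K = {})"

definition exchange :: "'a set \<Rightarrow> 'a set set \<Rightarrow> 'a set set \<Rightarrow> 'a set set" where
  "exchange K \<mu> \<nu> = {e \<in> \<mu>. \<not> e \<inter> V \<subseteq> K} \<union> {e \<in> \<nu>. e \<inter> V \<subseteq> K}"

definition matching_weight :: "('a set \<Rightarrow> 'w::comm_ring_1) \<Rightarrow> 'a set \<Rightarrow> 'w" where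
  "matching_weight w X = (\<Sum>\<mu>\<in>matchings_on X. \<Prod>e\<in>\<mu>. w e)"

section \<open>Matchings and parity\<close>

lemma matchings_onD:
  assumes "\<mu> \<in> matchings_on X"
  shows "\<mu> \<subseteq> E" "finite \<mu>" "\<And>e. e \<in> \<mu> \<Longrightarrow> e \<inter> V \<subseteq> X"
    "\<And>v. v \<in> X \<Longrightarrow> \<exists>!e. e \<in> \<mu> \<and> v \<in> e"
  using assms finite_E finite_subset[of \<mu> E] unfolding matchings_on_def by blast+

lemma ends_nonempty: "e \<in> E \<Longrightarrow> e \<inter> V \<noteq> {}"
  using card_ends by fastforce

lemma finite_matchings_on: "finite (matchings_on X)"
  by (rule finite_subset[of _ "Pow E"]) (auto simp: matchings_on_def finite_E)

text \<open>The two-element end sets of the edges of \<mu> partition \<open>X\<close>.\<close>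

lemma card_matching:
  assumes "\<mu> \<in> matchings_on X" "X \<subseteq> V"
  shows "card X = 2 * card \<mu>"
proof -
  note D = matchings_onD[OF assms(1)]
  have "X = (\<Union>e\<in>\<mu>. e \<inter> V)"
  proof (intro equalityI subsetI)
    fix v assume v: "v \<in> X"
    then show "v \<in> (\<Union>e\<in>\<mu>. e \<inter> V)"
      using D(4)[OF v] assms(2) by blast
  qed (use D(3) in blast)
  then have "card X = card (\<Union>e\<in>\<mu>. e \<inter> V)"
    by simp
  also have "\<dots> = (\<Sum>e\<in>\<mu>. card (e \<inter> V))"
  proof (rule card_UN_disjoint)
    show "\<forall>e\<in>\<mu>. \<forall>f\<in>\<mu>. e \<noteq> f \<longrightarrow> (e \<inter> V) \<inter> (f \<inter> V) = {}"
    proof (intro ballI impI equals0I)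
      fix e f v assume ef: "e \<in> \<mu>" "f \<in> \<mu>" "e \<noteq> f" and v: "v \<in> (e \<inter> V) \<inter> (f \<inter> V)"
      then have "v \<in> X"
        using D(3)[OF ef(1)] by blast
      from D(4)[OF this] show False
        using ef v by (auto simp: Ex1_def)
    qed
  qed (use D(2) finite_V in auto)
  also have "\<dots> = (\<Sum>e\<in>\<mu>. 2)"
    using D(1) card_ends by (intro sum.cong) auto
  finally show ?thesis by simp
qed

lemma matching_weight_odd:
  assumes "X \<subseteq> V" "odd (card X)"
  shows "matching_weight w X = 0"
proof -
  have "matchings_on X = {}"
    using card_matching[OF _ assms(1)] assms(2) by fastforce
  then show ?thesis by (simp add: matching_weight_def)
qed

section \<open>Exchanging matchings on a saturated set\<close>

lemma saturated_subset: "saturated N K \<Longrightarrow> M \<subseteq> N \<Longrightarrow> saturated M K"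
  by (auto simp: saturated_def)

lemma saturated_UN: "(\<And>i. i \<in> I \<Longrightarrow> saturated N (K i)) \<Longrightarrow> saturated N (\<Union>i\<in>I. K i)"
  unfolding saturated_def by blast

lemma restrict_matching:
  assumes "\<mu> \<in> matchings_on X" "X \<subseteq> V" "saturated \<mu> K"
  shows "{e \<in> \<mu>. e \<inter> V \<subseteq> K} \<in> matchings_on (X \<inter> K)"
proof -
  note D = matchings_onD[OF assms(1)]
  have "\<exists>!e. e \<in> {e \<in> \<mu>. e \<inter> V \<subseteq> K} \<and> v \<in> e" if v: "v \<in> X \<inter> K" for v
  proof -
    have "\<exists>!e. e \<in> \<mu> \<and> v \<in> e"
      using v by (intro D(4)) simp
    then obtain e where e: "e \<in> \<mu>" "v \<in> e" and uniq: "\<And>f. f \<in> \<mu> \<Longrightarrow> v \<in> f \<Longrightarrow> f = e"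
      by blast
    have "v \<in> e \<inter> V \<inter> K"
      using e(2) v assms(2) by auto
    then have "e \<inter> V \<subseteq> K"
      using e(1) assms(3) unfolding saturated_def by (metis empty_iff)
    then show ?thesis
      using e by (intro ex1I[of _ e]) (simp, rule uniq, simp_all)
  qed
  moreover have "e \<inter> V \<subseteq> X \<inter> K" if "e \<in> {e \<in> \<mu>. e \<inter> V \<subseteq> K}" for e
    using that D(3)[of e] by simp
  ultimately show ?thesis
    using D(1) unfolding matchings_on_def by (intro CollectI conjI ballI) auto
qed

text \<open>At a vertex of \<open>K\<close> the exchanged set has exactly the edges of \<nu>, at any
  other vertex exactly those of \<mu>; saturation prevents an edge from mixing the two kinds of
  vertices.\<close>

lemma exchange_matching:
  assumes \<mu>: "\<mu> \<in> matchings_on X" "X \<subseteq> V" and \<nu>: "\<nu> \<in> matchings_on Y" "Y \<subseteq> V"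
    and sat: "saturated (\<mu> \<union> \<nu>) K"
  shows "exchange K \<mu> \<nu> \<in> matchings_on (X - K \<union> Y \<inter> K)"
proof -
  note D = matchings_onD[OF \<mu>(1)] and D' = matchings_onD[OF \<nu>(1)]
  have inter: "e \<inter> V \<subseteq> K \<longleftrightarrow> e \<inter> V \<inter> K \<noteq> {}" if "e \<in> \<mu> \<union> \<nu>" for e
  proof -
    have "e \<inter> V \<noteq> {}"
      using that ends_nonempty D(1) D'(1) by blast
    moreover have "e \<inter> V \<subseteq> K \<or> e \<inter> V \<inter> K = {}"
      using that sat by (simp add: saturated_def)
    ultimately show ?thesis by blast
  qed
  have "\<exists>!e. e \<in> exchange K \<mu> \<nu> \<and> v \<in> e" if v: "v \<in> X - K \<union> Y \<inter> K" for v
  proof (cases "v \<in> K")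
    case True
    then obtain e where e: "e \<in> \<nu>" "v \<in> e" "\<And>f. f \<in> \<nu> \<Longrightarrow> v \<in> f \<Longrightarrow> f = e"
      using v D'(4)[of v] by blast
    have "v \<in> V" using v True \<nu> by blast
    then have "f \<in> exchange K \<mu> \<nu> \<and> v \<in> f \<longleftrightarrow> f \<in> \<nu> \<and> v \<in> f" for f
      using True inter[of f] unfolding exchange_def by blast
    then show ?thesis using e by metis
  next
    case False
    then obtain e where e: "e \<in> \<mu>" "v \<in> e" "\<And>f. f \<in> \<mu> \<Longrightarrow> v \<in> f \<Longrightarrow> f = e"
      using v D(4)[of v] by blast
    have "v \<in> V" using v False \<mu> by blast
    then have "f \<in> exchange K \<mu> \<nu> \<and> v \<in> f \<longleftrightarrow> f \<in> \<mu> \<and> v \<in> f" for f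
      using False unfolding exchange_def by blast
    then show ?thesis using e by metis
  qed
  moreover have "exchange K \<mu> \<nu> \<subseteq> E"
    using D(1) D'(1) by (auto simp: exchange_def)
  moreover have "e \<inter> V \<subseteq> X - K \<union> Y \<inter> K" if "e \<in> exchange K \<mu> \<nu>" for e
  proof (cases "e \<inter> V \<subseteq> K")
    case True
    then show ?thesis using that D'(3) by (auto simp: exchange_def)
  next
    case False
    then have "e \<in> \<mu>" using that by (auto simp: exchange_def)
    then show ?thesis using False inter[of e] D(3) by blast
  qed
  ultimately show ?thesis
    unfolding matchings_on_def by blast
qed

lemma prod_exchange:
  fixes w :: "'a set \<Rightarrow> 'w::comm_ring_1"
  assumes "finite \<mu>" "finite \<nu>"
  shows "(\<Prod>e\<in>exchange K \<mu> \<nu>. w e) * (\<Prod>e\<in>exchange K \<nu> \<mu>. w e) = (\<Prod>e\<in>\<mu>. w e) * (\<Prod>e\<in>\<nu>. w e)"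
proof -
  have split: "(\<Prod>e\<in>exchange K \<mu> \<nu>. w e)
      = (\<Prod>e\<in>{e \<in> \<mu>. \<not> e \<inter> V \<subseteq> K}. w e) * (\<Prod>e\<in>{e \<in> \<nu>. e \<inter> V \<subseteq> K}. w e)"
    if "finite \<mu>" "finite \<nu>" for \<mu> \<nu>
    unfolding exchange_def using that by (intro prod.union_disjoint) auto
  \<comment> \<open>With this, \<open>split\<close> for a pair of equal matchings factors a single
    product into its parts within and not within \<open>K\<close>. Both sides then have the same
    four factors, also when the matchings share edges.\<close>
  have self: "exchange K \<mu> \<mu> = \<mu>" for \<mu>
    by (auto simp: exchange_def)
  show ?thesis
    using split[OF assms] split[OF assms(2,1)] split[OF assms(1,1)] split[OF assms(2,2)]
    by (simp add: self algebra_simps)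
qed

lemma exchange_Un: "exchange K \<mu> \<nu> \<union> exchange K \<nu> \<mu> = \<mu> \<union> \<nu>"
  by (auto simp: exchange_def)

lemma exchange_exchange: "exchange K (exchange K \<mu> \<nu>) (exchange K \<nu> \<mu>) = \<mu>"
  by (auto simp: exchange_def)

section \<open>Components of a superposition and their terminals\<close>

lemma sym_adjacent: "sym (adjacent N)"
  by (auto simp: adjacent_def sym_def)

lemma component_of_self: "v \<in> component_of N v"
  by (simp add: component_of_def)

lemma component_of_subset: "v \<in> V \<Longrightarrow> component_of N v \<subseteq> V"
proof
  fix u assume v: "v \<in> V" and "u \<in> component_of N v"
  then have "(v, u) \<in> (adjacent N)\<^sup>*" by (simp add: component_of_def)
  then show "u \<in> V"
    by (induction rule: rtrancl_induct) (use v in \<open>auto simp: adjacent_def\<close>)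
qed

lemma component_of_eq:
  assumes "u \<in> component_of N v"
  shows "component_of N u = component_of N v"
proof -
  have "(v, u) \<in> (adjacent N)\<^sup>*" "(u, v) \<in> (adjacent N)\<^sup>*"
    using assms sym_rtrancl[OF sym_adjacent, of N] by (auto simp: component_of_def dest: symD)
  then show ?thesis
    unfolding component_of_def by (auto intro: rtrancl_trans)
qed

lemma component_of_disjoint:
  "component_of N u \<noteq> component_of N v \<Longrightarrow> component_of N u \<inter> component_of N v = {}"
  using component_of_eq by blast

lemma component_of_step:
  assumes "x \<in> component_of N v" "e \<in> N" "x \<in> e" "y \<in> e" "x \<in> V" "y \<in> V"
  shows "y \<in> component_of N v"
proof -
  have "(x, y) \<in> adjacent N"
    using assms by (auto simp: adjacent_def)
  then show ?thesis
    using assms(1) by (auto simp: component_of_def intro: rtrancl_into_rtrancl)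
qed

lemma saturated_component_of: "saturated N (component_of N v)"
  unfolding saturated_def using component_of_step[of _ N v] by blast

text \<open>A vertex set grown from \<open>v\<close> along edges gains an edge with every vertex.\<close>

lemma card_component_of:
  assumes N: "N \<subseteq> E" and v: "v \<in> V"
  shows "card (component_of N v) \<le> card {e \<in> N. e \<inter> V \<subseteq> component_of N v} + 1"
proof -
  let ?C = "component_of N v" and ?ed = "\<lambda>S. {e \<in> N. e \<inter> V \<subseteq> S}"
  define \<S> where "\<S> = {S. S \<subseteq> ?C \<and> v \<in> S \<and> card S \<le> card (?ed S) + 1}"
  have CV: "?C \<subseteq> V"
    using component_of_subset[OF v] .
  then have finC: "finite ?C"
    using finite_V finite_subset by blast
  then have "finite \<S>"
    by (auto simp: \<S>_def intro: finite_subset[of _ "Pow ?C"])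
  moreover have "{v} \<in> \<S>"
    by (auto simp: \<S>_def component_of_self)
  ultimately obtain S where S: "S \<in> \<S>" and max: "\<And>S'. S' \<in> \<S> \<Longrightarrow> S \<subseteq> S' \<Longrightarrow> S = S'"
    using finite_has_maximal[of \<S>] by blast
  have finN: "finite N"
    using N finite_E finite_subset by blast
  \<comment> \<open>A maximal grown set is closed under adjacency: a neighbour \<open>y\<close>
    outside \<open>S\<close> would bring along the edge \<open>e\<close>, which is not yet counted
    because its end \<open>y\<close> is new.\<close>
  have "y \<in> S" if x: "x \<in> S" and xy: "(x, y) \<in> adjacent N" for x y
  proof (rule ccontr)
    assume y: "y \<notin> S"
    obtain e where e: "e \<in> N" "x \<in> e \<inter> V" "y \<in> e \<inter> V"
      using xy by (auto simp: adjacent_def)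
    have "card (e \<inter> V) = 2"
      using e N card_ends by blast
    moreover have "card {x, y} = 2"
      using x y by (metis card_2_iff)
    ultimately have eV: "e \<inter> V = {x, y}"
      using e card_seteq[of "e \<inter> V" "{x, y}"] finite_V by auto
    have yC: "y \<in> ?C"
      using e S x component_of_step[of x N v e y] by (auto simp: \<S>_def)
    have "card (insert e (?ed S)) \<le> card (?ed (insert y S))"
      using finN eV e(1) x by (intro card_mono) auto
    moreover have "card (insert e (?ed S)) = card (?ed S) + 1"
      using finN eV y by (subst card_insert_disjoint) auto
    moreover have "finite S"
      using S finC finite_subset by (auto simp: \<S>_def)
    ultimately have "insert y S \<in> \<S>"
      using S y yC by (auto simp: \<S>_def)
    then show False
      using max y by blast
  qed
  then have "?C \<subseteq> S"
    using S Image_closed_trancl[of "adjacent N" S] unfolding \<S>_def component_of_def by blast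
  then show ?thesis
    using S by (auto simp: \<S>_def)
qed

text \<open>If \<mu> and \<nu> have p and q edges in \<open>C\<close>, they cover 2p and 2q of its
  vertices, so the two uncovered counts add up to 2|C| - 2p - 2q. This is even, and at most 2
  because a connected \<open>C\<close> has at most p + q + 1 vertices.\<close>

lemma card_uncovered_component_of:
  assumes \<mu>: "\<mu> \<in> matchings_on X" "X \<subseteq> V" and \<nu>: "\<nu> \<in> matchings_on Y" "Y \<subseteq> V" and v: "v \<in> V"
  defines "C \<equiv> component_of (\<mu> \<union> \<nu>) v"
  shows "even (card (C - X) + card (C - Y))" "card (C - X) + card (C - Y) \<le> 2"
proof -
  note D = matchings_onD[OF \<mu>(1)] and D' = matchings_onD[OF \<nu>(1)]
  have finC: "finite C"
    unfolding C_def using component_of_subset[OF v] finite_V finite_subset by blast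
  have sat: "saturated (\<mu> \<union> \<nu>) C"
    unfolding C_def by (rule saturated_component_of)
  have c1: "card (X \<inter> C) = 2 * card {e \<in> \<mu>. e \<inter> V \<subseteq> C}"
    using \<mu> sat by (intro card_matching restrict_matching) (auto intro: saturated_subset)
  have c2: "card (Y \<inter> C) = 2 * card {e \<in> \<nu>. e \<inter> V \<subseteq> C}"
    using \<nu> sat by (intro card_matching restrict_matching) (auto intro: saturated_subset)
  have s: "card C = card (C - S) + card (S \<inter> C)" for S
    using card_Int_Diff[OF finC, of S] by (simp add: Int_commute)
  have "{e \<in> \<mu> \<union> \<nu>. e \<inter> V \<subseteq> C} = {e \<in> \<mu>. e \<inter> V \<subseteq> C} \<union> {e \<in> \<nu>. e \<inter> V \<subseteq> C}"
    by blast
  then have "card {e \<in> \<mu> \<union> \<nu>. e \<inter> V \<subseteq> C} \<le> card {e \<in> \<mu>. e \<inter> V \<subseteq> C} + card {e \<in> \<nu>. e \<inter> V \<subseteq> C}"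
    by (simp add: card_Un_le)
  moreover have "card C \<le> card {e \<in> \<mu> \<union> \<nu>. e \<inter> V \<subseteq> C} + 1"
    unfolding C_def using D(1) D'(1) v by (intro card_component_of) auto
  ultimately show "card (C - X) + card (C - Y) \<le> 2"
    using c1 c2 s[of X] s[of Y] by linarith
  show "even (card (C - X) + card (C - Y))"
    using c1 c2 s[of X] s[of Y] by presburger
qed

text \<open>Each terminal is missed by exactly one of the two matchings, so the uncovered counts add
  up to the number of terminals in the component. It is even, at most 2, and positive because of
  \<open>v\<close>.\<close>

lemma card_terminals_component_of:
  assumes T: "T \<subseteq> V" "U \<subseteq> T" and \<mu>: "\<mu> \<in> matchings_on (V - U)" and \<nu>: "\<nu> \<in> matchings_on (V - (T - U))"
    and v: "v \<in> T"
  shows "card (component_of (\<mu> \<union> \<nu>) v \<inter> T) = 2"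
proof -
  let ?C = "component_of (\<mu> \<union> \<nu>) v"
  have vV: "v \<in> V" using T v by blast
  have CV: "?C \<subseteq> V" by (rule component_of_subset[OF vV])
  then have fin: "finite ?C"
    using finite_V finite_subset by blast
  have "card ((?C - (V - U)) \<union> (?C - (V - (T - U)))) = card (?C - (V - U)) + card (?C - (V - (T - U)))"
    using fin CV by (intro card_Un_disjoint) auto
  moreover have "(?C - (V - U)) \<union> (?C - (V - (T - U))) = ?C \<inter> T"
    using CV T by blast
  moreover have "card (?C \<inter> T) > 0"
    using fin v component_of_self[of v] by (auto simp: card_gt_0_iff)
  moreover have "even n \<Longrightarrow> n \<le> 2 \<Longrightarrow> 0 < n \<Longrightarrow> n = 2" for n :: nat
    by presburger
  ultimately show ?thesis
    using card_uncovered_component_of[OF \<mu> _ \<nu> _ vV] by simp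
qed

text \<open>Triples of a set \<open>U\<close> and two matchings are mapped by an exchange on the
  components meeting the symmetric difference of \<open>S\<close> and \<open>S'\<close>. Symmetry in
  \<open>S\<close> and \<open>S'\<close> lets one map serve as its own inverse.\<close>

lemma sum_matching_weight_exchange:
  fixes w :: "'a set \<Rightarrow> 'w::comm_ring_1"
  assumes T: "T \<subseteq> V" and S: "S \<subseteq> A" "S' \<subseteq> A" "A \<subseteq> T"
    and separated: "\<And>U \<mu> \<nu> x y. \<lbrakk>U \<subseteq> T; \<mu> \<in> matchings_on (V - U); \<nu> \<in> matchings_on (V - (T - U));
      x \<in> A; y \<in> A; y \<in> component_of (\<mu> \<union> \<nu>) x\<rbrakk> \<Longrightarrow> x = y"
  shows "(\<Sum>U | U \<subseteq> T \<and> U \<inter> A = S. matching_weight w (V - U) * matching_weight w (V - (T - U)))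
       = (\<Sum>U | U \<subseteq> T \<and> U \<inter> A = S'. matching_weight w (V - U) * matching_weight w (V - (T - U)))"
proof -
  define D where "D = (S - S') \<union> (S' - S)"
  define P where "P S = (SIGMA U:{U. U \<subseteq> T \<and> U \<inter> A = S}. matchings_on (V - U) \<times> matchings_on (V - (T - U)))" for S
  define K where "K N = (\<Union>d\<in>D. component_of N d)" for N
  define f where "f = (\<lambda>(U, \<mu>, \<nu>). (U - K (\<mu> \<union> \<nu>) \<union> (T - U) \<inter> K (\<mu> \<union> \<nu>),
      exchange (K (\<mu> \<union> \<nu>)) \<mu> \<nu>, exchange (K (\<mu> \<union> \<nu>)) \<nu> \<mu>))"
  define g :: "'a set \<times> 'a set set \<times> 'a set set \<Rightarrow> 'w"
    where "g = (\<lambda>(U, \<mu>, \<nu>). (\<Prod>e\<in>\<mu>. w e) * (\<Prod>e\<in>\<nu>. w e))"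
  have finT: "finite {U. U \<subseteq> T \<and> U \<inter> A = S}" for S
    using finite_subset[OF T finite_V] by (auto intro: finite_subset[of _ "Pow T"])
  have sum: "(\<Sum>U | U \<subseteq> T \<and> U \<inter> A = S. matching_weight w (V - U) * matching_weight w (V - (T - U)))
      = sum g (P S)" for S
    unfolding P_def g_def matching_weight_def
    by (subst sum.Sigma[symmetric])
      (auto simp: finT finite_matchings_on sum_product sum.cartesian_product intro!: sum.cong)
  have D: "D \<subseteq> A" using S by (auto simp: D_def)
  have maps: "f z \<in> P R'" "f (f z) = z" "g (f z) = g z"
    if zP: "z \<in> P R" and R: "R' = R - D \<union> (D - R)" for z R R'
  proof -
    obtain U \<mu> \<nu> where z: "z = (U, \<mu>, \<nu>)" and U: "U \<subseteq> T" "U \<inter> A = R"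
      and \<mu>: "\<mu> \<in> matchings_on (V - U)" and \<nu>: "\<nu> \<in> matchings_on (V - (T - U))"
      using zP by (auto simp: P_def)
    let ?K = "K (\<mu> \<union> \<nu>)" and ?U = "U - K (\<mu> \<union> \<nu>) \<union> (T - U) \<inter> K (\<mu> \<union> \<nu>)"
    have fz: "f z = (?U, exchange ?K \<mu> \<nu>, exchange ?K \<nu> \<mu>)"
      by (simp add: f_def z)
    have sat: "saturated (\<mu> \<union> \<nu>) ?K"
      unfolding K_def by (intro saturated_UN saturated_component_of)
    then have sat': "saturated (\<nu> \<union> \<mu>) ?K"
      by (simp add: Un_commute)
    \<comment> \<open>Here \<open>separated\<close> enters: a component chosen for a vertex of
      \<open>D\<close> contains no other vertex of \<open>A\<close>, so membership in
      \<open>U\<close> flips on \<open>A\<close> exactly at \<open>D\<close>.\<close>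
    have "?K \<inter> A = D"
    proof
      show "?K \<inter> A \<subseteq> D"
        using separated[OF U(1) \<mu> \<nu>] D unfolding K_def by blast
      show "D \<subseteq> ?K \<inter> A"
        using D component_of_self unfolding K_def by blast
    qed
    then have "?U \<inter> A = R'"
      using U S(3) R by blast
    moreover have "?U \<subseteq> T"
      using U by blast
    moreover have "exchange ?K \<mu> \<nu> \<in> matchings_on (V - ?U)"
    proof -
      have "V - U - ?K \<union> (V - (T - U)) \<inter> ?K = V - ?U"
        using U by blast
      then show ?thesis
        using exchange_matching[OF \<mu> _ \<nu> _ sat] by simp
    qed
    moreover have "exchange ?K \<nu> \<mu> \<in> matchings_on (V - (T - ?U))"
    proof -
      have "V - (T - U) - ?K \<union> (V - U) \<inter> ?K = V - (T - ?U)"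
        using U T by blast
      then show ?thesis
        using exchange_matching[OF \<nu> _ \<mu> _ sat'] by simp
    qed
    ultimately show "f z \<in> P R'"
      by (simp add: fz P_def)
    \<comment> \<open>The exchange preserves the union of the matchings, so a second application
      uses the same \<open>K\<close> and undoes the first.\<close>
    have "?U - ?K \<union> (T - ?U) \<inter> ?K = U"
      using U by blast
    then show "f (f z) = z"
      unfolding fz f_def by (simp add: exchange_Un exchange_exchange z)
    show "g (f z) = g z"
      using prod_exchange[OF matchings_onD(2)[OF \<mu>] matchings_onD(2)[OF \<nu>]]
      unfolding fz by (simp add: g_def z)
  qed
  have S': "S' = S - D \<union> (D - S)" "S = S' - D \<union> (D - S')"
    by (auto simp: D_def)
  have "sum g (P S) = sum g (P S')"
    by (rule sum.reindex_bij_witness[of _ f f])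
      (rule maps[OF _ S'(1)] maps[OF _ S'(2)], assumption)+
  then show ?thesis
    by (simp only: sum)
qed

end

subsection \<open>Non-crossing components in the plane\<close>

locale plane_drawing =
  fixes G :: drawing
  assumes plane: "plane_graph G"
begin

lemma edge_arc:
  assumes "e \<in> edges G"
  obtains g where "arc g" "path_image g = e" "e \<inter> verts G = {pathstart g, pathfinish g}"
proof -
  have "\<forall>e\<in>edges G. \<exists>g. arc g \<and> path_image g = e \<and> e \<inter> verts G = {pathstart g, pathfinish g}"
    using plane by (simp add: plane_graph_def)
  from bspec[OF this assms] obtain g where "arc g \<and> path_image g = e \<and> e \<inter> verts G = {pathstart g, pathfinish g}" ..
  then show thesis
    by (intro that[of g]) simp_all
qed

sublocale vertex_edge_system "verts G" "edges G"
proof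
  show "card (e \<inter> verts G) = 2" if e: "e \<in> edges G" for e
  proof -
    obtain g where "arc g" "e \<inter> verts G = {pathstart g, pathfinish g}"
      using edge_arc[OF e] by blast
    then show ?thesis
      by (auto dest: arc_distinct_ends)
  qed
qed (use plane in \<open>auto simp: plane_graph_def\<close>)

lemma matching_sum_delete_verts:
  assumes "U \<subseteq> verts G"
  shows "matching_sum w (delete_verts G U) = matching_weight w (verts G - U)"
proof -
  have disj: "e \<inter> U = {} \<longleftrightarrow> e \<inter> verts G \<subseteq> verts G - U" for e
    using assms by blast
  have "perfect_matchings (delete_verts G U) = matchings_on (verts G - U)"
    unfolding perfect_matchings_def matchings_on_def delete_verts_def by (auto simp: disj)
  then show ?thesis
    by (simp add: matching_sum_def matching_weight_def)
qed

text \<open>The component as a point set of the plane; \<open>insert x\<close> covers the case that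
  no edge of \<open>N\<close> ends at \<open>x\<close>.\<close>

definition component_drawing :: "complex set set \<Rightarrow> complex \<Rightarrow> complex set" where
  "component_drawing N x = insert x (\<Union>{e \<in> N. e \<inter> verts G \<subseteq> component_of N x})"

lemma path_component_component_drawing:
  assumes N: "N \<subseteq> edges G" and x: "x \<in> verts G" and y: "y \<in> component_of N x"
  shows "path_component (component_drawing N x) x y"
proof -
  have "(x, y) \<in> (adjacent N)\<^sup>*"
    using y by (simp add: component_of_def)
  then show ?thesis
  proof (induction rule: rtrancl_induct)
    case base
    then show ?case by (simp add: component_drawing_def path_component_refl_eq)
  next
    case (step y z)
    then obtain e where e: "e \<in> N" "y \<in> e" "z \<in> e" "y \<in> verts G" "z \<in> verts G"
      by (auto simp: adjacent_def)
    obtain g where g: "arc g" "path_image g = e"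
      using edge_arc e(1) N by blast
    have "path_connected e"
      using g path_connected_path_image arc_imp_path by blast
    then have "path_component e y z"
      using e by (simp add: path_connected_component)
    moreover have "y \<in> component_of N x"
      using step by (simp add: component_of_def)
    then have "e \<inter> verts G \<subseteq> component_of N x"
      using e component_of_step by blast
    then have "e \<subseteq> component_drawing N x"
      using e by (auto simp: component_drawing_def)
    ultimately show ?case
      using step.IH path_component_of_subset path_component_trans by blast
  qed
qed

lemma component_drawing_Int_verts:
  assumes "x \<in> verts G"
  shows "component_drawing N x \<inter> verts G = component_of N x"
proof
  show "component_drawing N x \<inter> verts G \<subseteq> component_of N x"
    using component_of_self by (auto simp: component_drawing_def)
  show "component_of N x \<subseteq> component_drawing N x \<inter> verts G"
  proof
    fix y assume y: "y \<in> component_of N x"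
    then have yV: "y \<in> verts G"
      using component_of_subset[OF assms] by blast
    have "(x, y) \<in> (adjacent N)\<^sup>*"
      using y by (simp add: component_of_def)
    then show "y \<in> component_drawing N x \<inter> verts G"
    proof (cases rule: rtranclE)
      case base
      then show ?thesis using yV by (simp add: component_drawing_def)
    next
      case (step z)
      then obtain e where e: "e \<in> N" "y \<in> e" "y \<in> verts G"
        by (auto simp: adjacent_def)
      then have "e \<inter> verts G \<subseteq> component_of N x"
        using component_of_step y by blast
      then show ?thesis
        using e by (auto simp: component_drawing_def)
    qed
  qed
qed

text \<open>A common point cannot be a vertex, since the components are disjoint. Otherwise it lies
  on two edges, distinct because their nonempty end sets are in different components, and distinct
  edges meet only at vertices.\<close>

lemma component_drawing_disjoint:
  assumes N: "N \<subseteq> edges G" and xy: "x \<in> verts G" "y \<in> verts G" "y \<notin> component_of N x"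
  shows "component_drawing N x \<inter> component_drawing N y = {}"
proof (rule ccontr)
  assume "component_drawing N x \<inter> component_drawing N y \<noteq> {}"
  then obtain z where z: "z \<in> component_drawing N x" "z \<in> component_drawing N y"
    by blast
  have disj: "component_of N x \<inter> component_of N y = {}"
    using xy component_of_eq component_of_self by blast
  then have "z \<notin> verts G"
    using z component_drawing_Int_verts xy by blast
  then obtain e f where ef: "e \<in> N" "e \<inter> verts G \<subseteq> component_of N x" "z \<in> e"
      "f \<in> N" "f \<inter> verts G \<subseteq> component_of N y" "z \<in> f"
    using z xy by (auto simp: component_drawing_def)
  have "e \<noteq> f"
    using ef disj ends_nonempty[of e] N by blast
  then show False
    using plane ef N \<open>z \<notin> verts G\<close> unfolding plane_graph_def by blast
qed

text \<open>The curve and its inside lie in \<open>F\<close> apart from the terminals, and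
  \<open>F\<close> misses the drawing. The drawn components therefore avoid the inside and touch the
  curve just at their two terminals, which alternate along it; so they meet.\<close>

lemma components_not_crossing:
  assumes face: "in_cyclic_order_on_face G F vs" and N: "N \<subseteq> edges G"
    and idx: "i < j" "j < l" "l < m" "m < length vs"
    and il: "component_of N (vs ! i) \<inter> set vs = {vs ! i, vs ! l}"
    and jm: "component_of N (vs ! j) \<inter> set vs = {vs ! j, vs ! m}"
  shows "vs ! j \<in> component_of N (vs ! i)"
proof (rule ccontr)
  assume sep: "vs ! j \<notin> component_of N (vs ! i)"
  obtain c t where F: "F \<in> faces G" and vs: "set vs \<subseteq> verts G"
    and c: "simple_path c" "pathfinish c = pathstart c" "path_image c \<subseteq> F \<union> set vs"
      "inside (path_image c) \<subseteq> F"
    and t_all: "\<forall>i<length vs. 0 \<le> t i \<and> t i < 1 \<and> c (t i) = vs ! i"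
      "\<forall>i j. i < j \<and> j < length vs \<longrightarrow> t i < (t j :: real)"
    using face unfolding in_cyclic_order_on_face_def by (elim conjE exE) (rule that; assumption)
  have t: "0 \<le> t i \<and> t i < 1 \<and> c (t i) = vs ! i" if "i < length vs" for i
    using t_all(1) that by simp
  have t_mono: "t i < t j" if "i < j" "j < length vs" for i j
    using t_all(2) that by simp
  have Fdisj: "F \<inter> (verts G \<union> \<Union>(edges G)) = {}"
    using F in_components_subset unfolding faces_def by blast
  have sub: "component_drawing N x \<subseteq> verts G \<union> \<Union>(edges G)" if "x \<in> verts G" for x
    using that N by (auto simp: component_drawing_def)
  have onc: "vs ! x \<in> path_image c" if "x < length vs" for x
    using t[OF that] by (metis atLeastAtMost_iff image_eqI less_eq_real_def path_image_def)
  have meet: "component_drawing N (vs ! x) \<inter> path_image c = {c (t x), c (t y)}"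
    if "x < length vs" "y < length vs" "component_of N (vs ! x) \<inter> set vs = {vs ! x, vs ! y}" for x y
  proof -
    have xV: "vs ! x \<in> verts G"
      using vs that by auto
    have "component_drawing N (vs ! x) \<inter> path_image c \<subseteq> component_of N (vs ! x) \<inter> set vs"
      using sub[OF xV] Fdisj c(3) vs component_drawing_Int_verts[OF xV, of N] by blast
    moreover have "{vs ! x, vs ! y} \<subseteq> component_drawing N (vs ! x) \<inter> path_image c"
      using that onc component_drawing_Int_verts[OF xV, of N] by blast
    ultimately show ?thesis
      using that t by auto
  qed
  have ins: "component_drawing N (vs ! x) \<inter> inside (path_image c) = {}" if "x < length vs" for x
    using sub[of "vs ! x"] Fdisj c(4) vs that nth_mem by blast
  have conn: "path_component (component_drawing N (vs ! x)) (c (t x)) (c (t y))"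
    if "x < length vs" "y < length vs" "component_of N (vs ! x) \<inter> set vs = {vs ! x, vs ! y}" for x y
    using path_component_component_drawing[OF N, of "vs ! x" "vs ! y"] that vs t nth_mem by auto
  have "component_drawing N (vs ! i) \<inter> component_drawing N (vs ! j) \<noteq> {}"
    by (rule crossing_connections_outside[OF c(1,2), of "t i" "t j" "t l" "t m"])
      (use idx t t_mono meet[of i l] meet[of j m] ins conn[of i l] conn[of j m] il jm in auto)
  moreover have "vs ! i \<in> verts G" "vs ! j \<in> verts G"
    using idx by (auto intro!: subsetD[OF vs])
  ultimately show False
    using component_drawing_disjoint[OF N _ _ sep] by blast
qed

text \<open>The components of the superposition pair up the terminals without crossings, so an even
  number of terminals lies between two that are paired.\<close>

lemma odd_diff_paired_terminals:
  assumes face: "in_cyclic_order_on_face G F vs" and dist: "distinct vs"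
    and U: "U \<subseteq> set vs" and \<mu>: "\<mu> \<in> matchings_on (verts G - U)"
    and \<nu>: "\<nu> \<in> matchings_on (verts G - (set vs - U))"
    and ij: "i < j" "j < length vs" "vs ! j \<in> component_of (\<mu> \<union> \<nu>) (vs ! i)"
  shows "odd (j - i)"
proof -
  let ?C = "\<lambda>q. component_of (\<mu> \<union> \<nu>) (vs ! q)"
  have N: "\<mu> \<union> \<nu> \<subseteq> edges G"
    using matchings_onD(1)[OF \<mu>] matchings_onD(1)[OF \<nu>] by blast
  have vs: "set vs \<subseteq> verts G"
    using face by (simp add: in_cyclic_order_on_face_def)
  have two: "card (?C q \<inter> set vs) = 2" if "q < length vs" for q
    using card_terminals_component_of[OF vs U \<mu> \<nu>] that by simp
  have pair: "?C q \<inter> set vs = {vs ! q, vs ! m}"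
    if "q < length vs" "m < length vs" "q \<noteq> m" "vs ! m \<in> ?C q" for q m
  proof -
    have "card {vs ! q, vs ! m} = 2"
      using that dist by (simp add: nth_eq_iff_index_eq)
    moreover have "{vs ! q, vs ! m} \<subseteq> ?C q \<inter> set vs"
      using that component_of_self by simp
    ultimately show ?thesis
      using two[OF that(1)] by (intro card_subset_eq[symmetric]) simp_all
  qed
  \<comment> \<open>The partner of a terminal strictly between positions \<open>i\<close> and
    \<open>j\<close> also lies strictly between them. A partner before \<open>i\<close> or after
    \<open>j\<close> would give alternating pairs in different components.\<close>
  have inner: "m \<in> {i<..<j}" if q: "q \<in> {i<..<j}" and m: "m < length vs" "vs ! m \<in> ?C q" for q m
  proof -
    have idx: "i < length vs" "q < length vs" "i < q" "q < j" "i \<noteq> j"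
      using ij q by auto
    have ne: "vs ! q \<noteq> vs ! i" "vs ! q \<noteq> vs ! j"
      using nth_eq_iff_index_eq[OF dist] idx ij(2) by auto
    have Ci: "?C i \<inter> set vs = {vs ! i, vs ! j}"
      by (rule pair[OF idx(1) ij(2) idx(5) ij(3)])
    have "vs ! q \<notin> ?C i"
    proof
      assume "vs ! q \<in> ?C i"
      then have "vs ! q \<in> ?C i \<inter> set vs"
        using idx(2) by simp
      then show False
        unfolding Ci using ne by simp
    qed
    then have iq: "?C i \<noteq> ?C q"
      using component_of_self by metis
    have mq: "?C m = ?C q" and ji: "?C j = ?C i"
      by (rule component_of_eq[OF m(2)], rule component_of_eq[OF ij(3)])
    have "m \<noteq> i" "m \<noteq> j"
      using iq mq ji by metis+
    moreover have "\<not> m < i"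
    proof
      assume "m < i"
      then have "?C m \<inter> set vs = {vs ! m, vs ! q}"
        using idx m(1) component_of_self[of "vs ! q"] mq by (intro pair) auto
      then have "vs ! i \<in> ?C m"
        by (rule components_not_crossing[OF face N \<open>m < i\<close> idx(3,4) ij(2) _ Ci])
      then show False
        using iq mq component_of_eq by metis
    qed
    moreover have "\<not> j < m"
    proof
      assume "j < m"
      then have "?C q \<inter> set vs = {vs ! q, vs ! m}"
        using idx m by (intro pair) auto
      then have "vs ! q \<in> ?C i"
        by (rule components_not_crossing[OF face N idx(3,4) \<open>j < m\<close> m(1) Ci])
      then show False
        using iq component_of_eq by metis
    qed
    ultimately show ?thesis by auto
  qed
  define \<C> where "\<C> = (\<lambda>q. ?C q \<inter> set vs) ` {i<..<j}"
  have Un: "\<Union>\<C> = (!) vs ` {i<..<j}"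
  proof
    show "\<Union>\<C> \<subseteq> (!) vs ` {i<..<j}"
    proof
      fix y assume "y \<in> \<Union>\<C>"
      then obtain q m where q: "q \<in> {i<..<j}" and m: "m < length vs" "vs ! m \<in> ?C q" "y = vs ! m"
        unfolding \<C>_def by (auto simp: in_set_conv_nth)
      then show "y \<in> (!) vs ` {i<..<j}"
        using inner[OF q m(1,2)] by simp
    qed
    show "(!) vs ` {i<..<j} \<subseteq> \<Union>\<C>"
    proof
      fix y assume "y \<in> (!) vs ` {i<..<j}"
      then obtain q where q: "q \<in> {i<..<j}" "y = vs ! q"
        by blast
      then have "y \<in> ?C q \<inter> set vs"
        using ij(2) component_of_self by simp
      then show "y \<in> \<Union>\<C>"
        using q(1) unfolding \<C>_def by blast
    qed
  qed
  \<comment> \<open>The pairs, collected as sets so that each counts once, partition the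
    \<open>j - i - 1\<close> terminals strictly between.\<close>
  have "2 * card \<C> = card (\<Union>\<C>)"
  proof (rule card_partition)
    show "card c = 2" if "c \<in> \<C>" for c
      using that two ij by (auto simp: \<C>_def)
    show "c \<inter> d = {}" if cd: "c \<in> \<C>" "d \<in> \<C>" "c \<noteq> d" for c d
    proof -
      obtain p q where pq: "c = ?C p \<inter> set vs" "d = ?C q \<inter> set vs"
        using cd(1,2) unfolding \<C>_def by blast
      then have "?C p \<noteq> ?C q"
        using cd(3) by metis
      from component_of_disjoint[OF this] show ?thesis
        unfolding pq by blast
    qed
  qed (auto simp: Un, simp add: \<C>_def)
  also have "card (\<Union>\<C>) = j - i - 1"
    unfolding Un using dist ij by (subst card_image) (auto simp: inj_on_def nth_eq_iff_index_eq)
  finally show ?thesis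
    using ij(1) by presburger
qed

end

text \<open>The terminals are numbered from 1 and list positions from 0, which places the vertices
  of \<open>A\<close> at even positions.\<close>

lemma concat_pairs_nth:
  "length (concat (map (\<lambda>i. [a i, b i]) [1..<k+1])) = 2 * k"
  "i < k \<Longrightarrow> concat (map (\<lambda>i. [a i, b i]) [1..<k+1]) ! (2 * i) = a (Suc i)"
proof -
  show len: "length (concat (map (\<lambda>i. [a i, b i]) [1..<k+1])) = 2 * k" for k
    by (induction k) auto
  show "i < k \<Longrightarrow> concat (map (\<lambda>i. [a i, b i]) [1..<k+1]) ! (2 * i) = a (Suc i)"
  proof (induction k)
    case (Suc k)
    then show ?case
      using len[of k] by (cases "i = k") (auto simp: nth_append less_Suc_eq)
  qed simp
qed

theorem theorem2p1:
  fixes G :: drawing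
    and w :: "complex set \<Rightarrow> 'w::comm_ring_1"
    and F :: "complex set"
    and a b :: "nat \<Rightarrow> complex"
    and n k :: nat
    and A B A1 A2 :: "complex set"
  assumes "plane_graph G"
    and "card (verts G) = 2 * n"
    and "2 \<le> k" and "k \<le> n"
    and "distinct (concat (map (\<lambda>i. [a i, b i]) [1..<k+1]))"
    and "in_cyclic_order_on_face G F (concat (map (\<lambda>i. [a i, b i]) [1..<k+1]))"
    and "A = a ` {1..k}" and "B = b ` {1..k}"
    and "A1 \<union> A2 = A" and "A1 \<inter> A2 = {}"
  shows "(\<Sum>W | W \<subseteq> B \<and> even (card W).
             matching_sum w (delete_verts G W) *
             matching_sum w (delete_verts G (A \<union> (B - W)))) =
         (\<Sum>Y | Y \<subseteq> B \<and> even (int (card Y) - int (card A1)).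
             matching_sum w (delete_verts G (A1 \<union> Y)) *
             matching_sum w (delete_verts G (A2 \<union> (B - Y))))"
proof -
  interpret plane_drawing G
    using assms(1) by unfold_locales
  let ?V = "verts G" and ?T = "A \<union> B"
  define vs where "vs = concat (map (\<lambda>i. [a i, b i]) [1..<k+1])"
  note face = assms(6)[folded vs_def] and dist = assms(5)[folded vs_def]
  have len: "length vs = 2 * k" and nth: "\<And>i. i < k \<Longrightarrow> vs ! (2 * i) = a (Suc i)"
    unfolding vs_def by (rule concat_pairs_nth; assumption)+
  have "{1..<k+1} = {1..k}"
    by auto
  then have set_vs: "set vs = ?T"
    unfolding vs_def assms(7,8) by auto
  have T: "?T \<subseteq> ?V"
    using face set_vs by (simp add: in_cyclic_order_on_face_def)
  have fin: "finite A" "finite B"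
    using assms by auto
  \<comment> \<open>Disjointness of \<open>A\<close> and \<open>B\<close> follows by counting: their
    union has 2k elements, while each has at most k.\<close>
  have "card (set vs) = 2 * k"
    using dist len distinct_card by fastforce
  then have "card (A \<union> B) = 2 * k"
    by (simp add: set_vs)
  moreover have "card A \<le> k" "card B \<le> k"
    unfolding assms(7,8) using card_image_le[of "{1..k}"] by force+
  ultimately have "card (A \<inter> B) = 0"
    using card_Un_Int[OF fin] by linarith
  then have AB: "A \<inter> B = {}"
    using fin by simp
  have A_index: "\<exists>i<length vs. even i \<and> vs ! i = x" if x: "x \<in> A" for x
  proof -
    obtain i where i: "i \<in> {1..k}" "x = a i"
      using x assms(7) by blast
    then show ?thesis
      using nth[of "i - 1"] len by (intro exI[of _ "2 * (i - 1)"]) auto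
  qed
  have separated: "x = y"
    if U: "U \<subseteq> ?T" and \<mu>: "\<mu> \<in> matchings_on (?V - U)" and \<nu>: "\<nu> \<in> matchings_on (?V - (?T - U))"
      and xy: "x \<in> A" "y \<in> A" "y \<in> component_of (\<mu> \<union> \<nu>) x" for U \<mu> \<nu> x y
  proof (rule ccontr)
    assume "x \<noteq> y"
    obtain i j where ij: "i < length vs" "even i" "vs ! i = x" "j < length vs" "even j" "vs ! j = y"
      using A_index xy by meson
    have "x \<in> component_of (\<mu> \<union> \<nu>) y"
      using xy component_of_eq component_of_self by blast
    \<comment> \<open>Either position may come first. Truncated subtraction is harmless, since the
      difference of two even positions is even in both orders.\<close>
    then have "odd (j - i) \<or> odd (i - j)"
      using odd_diff_paired_terminals[OF face dist, unfolded set_vs, OF U \<mu> \<nu>] ij xy \<open>x \<noteq> y\<close>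
      by (metis linorder_neqE_nat)
    then show False
      using ij by auto
  qed
  \<comment> \<open>Substituting \<open>U = S \<union> Y\<close> turns
    \<open>A - S \<union> (B - Y)\<close> into the complement of \<open>U\<close> among the
    terminals.\<close>
  have sum: "(\<Sum>Y | Y \<subseteq> B \<and> even (int (card Y) - int (card S)).
        matching_sum w (delete_verts G (S \<union> Y)) * matching_sum w (delete_verts G (A - S \<union> (B - Y))))
      = (\<Sum>U | U \<subseteq> ?T \<and> U \<inter> A = S. matching_weight w (?V - U) * matching_weight w (?V - (?T - U)))"
    (is "?lhs = ?rhs") if S: "S \<subseteq> A" for S
  proof -
    let ?h = "\<lambda>Y. matching_weight w (?V - (S \<union> Y)) * matching_weight w (?V - (A - S \<union> (B - Y)))"
    have "?lhs = (\<Sum>Y | Y \<subseteq> B \<and> even (int (card Y) - int (card S)). ?h Y)"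
      using S T by (intro sum.cong refl arg_cong2[of _ _ _ _ "(*)"] matching_sum_delete_verts) auto
    also have "\<dots> = (\<Sum>Y | Y \<subseteq> B. ?h Y)"
    proof (rule sum.mono_neutral_left)
      show "\<forall>Y\<in>{Y. Y \<subseteq> B} - {Y. Y \<subseteq> B \<and> even (int (card Y) - int (card S))}. ?h Y = 0"
      proof
        fix Y assume "Y \<in> {Y. Y \<subseteq> B} - {Y. Y \<subseteq> B \<and> even (int (card Y) - int (card S))}"
        then have Y: "Y \<subseteq> B" "odd (card Y + card S)"
          by (auto simp: even_of_nat_iff)
        have "finite S" "finite Y"
          using Y S fin finite_subset by blast+
        then have c: "card (S \<union> Y) = card S + card Y"
          using Y S AB by (intro card_Un_disjoint) auto
        have sub: "S \<union> Y \<subseteq> ?V"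
          using Y S T by blast
        \<comment> \<open>Since \<open>G\<close> has an even number of vertices, a set
          \<open>Y\<close> of the wrong parity leaves an odd number of them, and the first factor
          vanishes.\<close>
        have "card (?V - (S \<union> Y)) + card (S \<union> Y) = 2 * n"
          using card_Diff_subset[of "S \<union> Y" ?V] card_mono[OF finite_V sub] sub assms(2)
            \<open>finite S\<close> \<open>finite Y\<close> by simp
        then have "odd (card (?V - (S \<union> Y)))"
          using c Y(2) by presburger
        then show "?h Y = 0"
          by (simp add: matching_weight_odd)
      qed
    qed (use fin in auto)
    also have "\<dots> = ?rhs"
    proof (rule sum.reindex_bij_witness[of _ "\<lambda>U. U \<inter> B" "\<lambda>Y. S \<union> Y"])
      fix Y assume Y: "Y \<in> {Y. Y \<subseteq> B}"
      then have "A - S \<union> (B - Y) = ?T - (S \<union> Y)"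
        using S AB by blast
      then show "matching_weight w (?V - (S \<union> Y)) * matching_weight w (?V - (?T - (S \<union> Y))) = ?h Y"
        by simp
    qed (use S AB in auto)
    finally show ?thesis .
  qed
  have "A2 = A - A1" "A1 \<subseteq> A"
    using assms(9,10) by blast+
  then show ?thesis
    using sum[of "{}"] sum[of A1] sum_matching_weight_exchange[OF T, of "{}" A A1 w] separated
    by simp
qed

end
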